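(* Let $k$ and $l$ be positive integers. There exist a linearly orderable group $G$ (written additively, but not necessarily abelian) and a $2$-element set $X \subseteq G$ such that $|k\cdot X+l\cdot X| < 3|X|-2$.
   Context: Groups are not assumed abelian, even when written additively. For an integer $k$ and a subset $X$ of an additively written group $G$, $k\cdot X=\{kx : x\in X\}$ (where $kx$ is the $k$-fold multiple of $x$, i.e. the $k$-th power in multiplicative notation), and $A+B=\{a+b : a\in A,\ b\in B\}$ for $A,B\subseteq G$. The group $G$ is linearly orderable if there is a total order $\preceq$ on $G$ such that $x+y\prec x+z$ and $y+x\prec z+x$ for all $x,y,z\in G$ with $y\prec z$. *)

theory Defs
  imports "HOL-Algebra.Coset"
begin

(* Possibly non-abelian groups are HOL-Algebra groups, whose notation is multiplicative:
   the sum a + b reads a \<otimes> b, the multiple k x reads x [^] k, and the sumset A + B is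
   the library's A <#> B. *)

definition dilate :: "('a, 'b) monoid_scheme \<Rightarrow> int \<Rightarrow> 'a set \<Rightarrow> 'a set" where
  "dilate G k X = {x [^]\<^bsub>G\<^esub> k | x. x \<in> X}"

(* r is the reflexive order, as a relation on the carrier; r - Id is its strict part. *)

definition linearly_orderable :: "('a, 'b) monoid_scheme \<Rightarrow> bool" where
  "linearly_orderable G \<longleftrightarrow>
    (\<exists>r. linear_order_on (carrier G) r \<and>
      (\<forall>x\<in>carrier G. \<forall>y\<in>carrier G. \<forall>z\<in>carrier G. (y, z) \<in> r - Id \<longrightarrow>
        (x \<otimes>\<^bsub>G\<^esub> y, x \<otimes>\<^bsub>G\<^esub> z) \<in> r - Id \<and>
        (y \<otimes>\<^bsub>G\<^esub> x, z \<otimes>\<^bsub>G\<^esub> x) \<in> r - Id))"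

(* Statements asserting the existence of a group use carriers of type nat set. For a claim
   about a finite subset X this loses nothing: the subgroup generated by X is countable,
   contains all sumsets of dilates of X, and is linearly orderable if the ambient group is. *)

end

theory Submission
  imports Complex_Main Defs
    "HOL-Library.Countable_Set"
    "HOL-Algebra.Generated_Groups"
    "HOL-Algebra.Weak_Morphisms"
begin

text \<open>
  For \<open>X = {x, y}\<close> the set \<open>k\<cdot>X + l\<cdot>X\<close> has the four elements
  \<open>x\<^sup>k x\<^sup>l, x\<^sup>k y\<^sup>l, y\<^sup>k x\<^sup>l, y\<^sup>k y\<^sup>l\<close>, and \<open>3|X| - 2 = 4\<close>, so one coincidence suffices.
  In an ordered group with \<open>x \<noteq> y\<close> the only possible one is \<open>x\<^sup>k y\<^sup>l = y\<^sup>k x\<^sup>l\<close>.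

  It occurs in the group of increasing affine maps of the real line. Give \<open>x\<close> and \<open>y\<close> the same
  slope \<open>a\<close>, say \<open>x(t) = a t\<close> and \<open>y(t) = a t + 1\<close>. Then \<open>x\<^sup>k y\<^sup>l\<close> and \<open>y\<^sup>k x\<^sup>l\<close> both have slope
  \<open>a\<^sup>k\<^sup>+\<^sup>l\<close>, and their translation parts agree exactly when
  \<open>a\<^sup>k (1 + a + \<dots> + a\<^sup>l\<^sup>-\<^sup>1) = 1 + a + \<dots> + a\<^sup>k\<^sup>-\<^sup>1\<close>. The intermediate value theorem on
  \<open>[0, 2]\<close> gives a positive solution \<open>a\<close> (lemma \<open>slope_exists\<close>). Comparing affine maps first by
  slope and then by translation part is an order invariant under multiplication on both sides.

  The affine group is uncountable, but everything happens inside the subgroup generated by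
  \<open>x\<close> and \<open>y\<close>, which is countable and therefore isomorphic to a group of natural numbers
  (lemma \<open>countable_subset_embeds\<close>). Both the order and the coincidence pull back along
  the embedding.
\<close>

section \<open>Orders and countable subgroups\<close>

lemma linearly_orderable_pullback:
  assumes H: "linearly_orderable H" and N: "group N"
    and hom: "h \<in> hom N H" and inj: "inj_on h (carrier N)"
  shows "linearly_orderable N"
proof -
  obtain r where lin: "linear_order_on (carrier H) r"
    and inv: "\<And>x y z. x \<in> carrier H \<Longrightarrow> y \<in> carrier H \<Longrightarrow> z \<in> carrier H \<Longrightarrow> (y, z) \<in> r - Id \<Longrightarrow>
        (x \<otimes>\<^bsub>H\<^esub> y, x \<otimes>\<^bsub>H\<^esub> z) \<in> r - Id \<and> (y \<otimes>\<^bsub>H\<^esub> x, z \<otimes>\<^bsub>H\<^esub> x) \<in> r - Id"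
    using H unfolding linearly_orderable_def by blast
  define s where "s = {(m, n). m \<in> carrier N \<and> n \<in> carrier N \<and> (h m, h n) \<in> r}"
  have closed: "h m \<in> carrier H" if "m \<in> carrier N" for m
    using hom that by (auto simp: hom_def)
  have s_strict: "(m, n) \<in> s - Id \<longleftrightarrow> (h m, h n) \<in> r - Id"
    if "m \<in> carrier N" "n \<in> carrier N" for m n
    using that inj by (auto simp: s_def inj_on_def)
  have r: "refl_on (carrier H) r" "trans r" "antisym r" "total_on (carrier H) r"
    using lin by (auto simp: linear_order_on_def partial_order_on_def preorder_on_def)
  have "linear_order_on (carrier N) s"
    unfolding linear_order_on_def partial_order_on_def preorder_on_def
  proof (intro conjI)
    show "s \<subseteq> carrier N \<times> carrier N" by (auto simp: s_def)
    show "refl_on (carrier N) s"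
      using r(1) closed by (auto simp: s_def refl_on_def)
    show "trans s"
      using r(2) unfolding s_def trans_def by blast
    show "antisym s"
      using r(3) inj unfolding s_def antisym_def inj_on_def by blast
    show "total_on (carrier N) s"
      using r(4) closed inj unfolding s_def total_on_def inj_on_def by blast
  qed
  moreover have "(x \<otimes>\<^bsub>N\<^esub> y, x \<otimes>\<^bsub>N\<^esub> z) \<in> s - Id \<and> (y \<otimes>\<^bsub>N\<^esub> x, z \<otimes>\<^bsub>N\<^esub> x) \<in> s - Id"
    if xyz: "x \<in> carrier N" "y \<in> carrier N" "z \<in> carrier N" and yz: "(y, z) \<in> s - Id" for x y z
  proof -
    interpret N: group N by (fact N)
    have "(h y, h z) \<in> r - Id"
      using s_strict xyz yz by blast
    from inv[OF closed closed closed this, of x] show ?thesis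
      using xyz by (simp add: s_strict hom_mult[OF hom] del: Diff_iff)
  qed
  ultimately show ?thesis
    unfolding linearly_orderable_def by blast
qed

context group
begin

text \<open>An element of the generated subgroup is the product of a finite word in the generators and
  their inverses, and a countable alphabet has only countably many words.\<close>

lemma countable_generate:
  assumes S: "S \<subseteq> carrier G" and "countable S"
  shows "countable (generate G S)"
proof -
  let ?A = "S \<union> m_inv G ` S"
  define word where "word xs = foldr (\<otimes>) xs \<one>" for xs
  have A: "?A \<subseteq> carrier G" using S by auto
  have word_closed: "word xs \<in> carrier G" if "xs \<in> lists ?A" for xs
    using that A by (induction xs) (auto simp: word_def)
  have word_append: "word (xs @ ys) = word xs \<otimes> word ys"
    if xs: "xs \<in> lists ?A" and ys: "ys \<in> lists ?A" for xs ys
    using xs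
  proof (induction xs)
    case Nil
    then show ?case using word_closed[OF ys] by (simp add: word_def)
  next
    case (Cons x xs)
    then have "word xs \<in> carrier G" "word ys \<in> carrier G" "x \<in> carrier G"
      using word_closed ys A by auto
    with Cons show ?case by (simp add: word_def m_assoc)
  qed
  have word_letter: "g \<in> word ` lists ?A" if "g \<in> ?A" for g
    using that A by (intro image_eqI[of _ _ "[g]"]) (auto simp: word_def)
  have "generate G S \<subseteq> word ` lists ?A"
  proof
    fix g assume "g \<in> generate G S"
    then show "g \<in> word ` lists ?A"
    proof induction
      case one
      show ?case by (rule image_eqI[of _ _ "[]"]) (auto simp: word_def)
    next
      case (incl g)
      then show ?case by (intro word_letter) auto
    next
      case (inv g)
      then show ?case by (intro word_letter) auto
    next
      case (eng g g')
      then obtain xs ys where "xs \<in> lists ?A" "ys \<in> lists ?A" "g = word xs" "g' = word ys"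
        by blast
      then show ?case
        by (intro image_eqI[of _ _ "xs @ ys"]) (auto simp: word_append)
    qed
  qed
  moreover have "countable (word ` lists ?A)"
    using \<open>countable S\<close> by auto
  ultimately show ?thesis by (rule countable_subset)
qed

lemma countable_subset_embeds:
  assumes S: "S \<subseteq> carrier G" and "countable S"
  obtains N :: "nat monoid" and h
  where "group N" "h \<in> hom N G" "inj_on h (carrier N)" "S \<subseteq> h ` carrier N"
proof -
  define C where "C = G\<lparr>carrier := generate G S\<rparr>"
  define f where "f = to_nat_on (carrier C)"
  define N where "N = image_group f C"
  define h where "h = inv_into (carrier C) f"
  have sub: "subgroup (generate G S) G"
    using S by (rule generate_is_subgroup)
  then have C: "group C"
    unfolding C_def by (rule subgroup_imp_group)
  have inj: "inj_on f (carrier C)"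
    unfolding f_def C_def using countable_generate[OF assms] by auto
  have iso: "f \<in> iso C N"
    unfolding N_def by (rule inj_imp_image_group_iso[OF inj])
  have grp: "group N"
    unfolding N_def by (rule group.inj_imp_image_group_is_group[OF C inj])
  have "h \<in> iso N C"
    unfolding h_def by (rule group.iso_set_sym[OF C iso])
  then have "h \<in> hom N C" and bij: "bij_betw h (carrier N) (carrier C)"
    by (auto simp: iso_def)
  then have "h \<in> hom N G"
    using subgroup.subset[OF sub] by (auto simp: hom_def C_def)
  moreover have "S \<subseteq> h ` carrier N"
    using bij by (auto simp: bij_betw_def C_def intro: generate.incl)
  ultimately show thesis
    using that grp bij by (auto simp: bij_betw_def)
qed

end

section \<open>The group of increasing affine maps\<close>

text \<open>The pair \<open>(a, b)\<close> stands for the map \<open>t \<mapsto> a t + b\<close>; multiplication is composition.\<close>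

definition affine_group :: "(real \<times> real) monoid" where
  "affine_group = \<lparr>carrier = {0<..} \<times> UNIV,
    mult = (\<lambda>(a, b) (c, d). (a * c, a * d + b)), one = (1, 0)\<rparr>"

lemma affine_group_simps [simp]:
  "(a, b) \<in> carrier affine_group \<longleftrightarrow> a > 0"
  "(a, b) \<otimes>\<^bsub>affine_group\<^esub> (c, d) = (a * c, a * d + b)"
  "\<one>\<^bsub>affine_group\<^esub> = (1, 0)"
  by (auto simp: affine_group_def)

lemma group_affine_group: "group affine_group"
proof (rule groupI)
  fix p assume "p \<in> carrier affine_group"
  then obtain a b where p: "p = (a, b)" "a > 0"
    by (cases p) auto
  then have "(1 / a, - b / a) \<otimes>\<^bsub>affine_group\<^esub> p = \<one>\<^bsub>affine_group\<^esub>"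
    by (simp add: field_simps)
  with p show "\<exists>q\<in>carrier affine_group. q \<otimes>\<^bsub>affine_group\<^esub> p = \<one>\<^bsub>affine_group\<^esub>"
    by (intro bexI[of _ "(1 / a, - b / a)"]) auto
qed (auto simp: algebra_simps)

text \<open>The lexicographic order works because slopes multiply like positive reals, and among maps of
  equal slope the translation part undergoes an increasing affine change under multiplication
  on either side.\<close>

lemma linearly_orderable_affine_group: "linearly_orderable affine_group"
proof -
  define r where "r = {((a :: real, b :: real), (c :: real, d :: real)).
    a > 0 \<and> c > 0 \<and> (a < c \<or> a = c \<and> b \<le> d)}"
  have "linear_order_on (carrier affine_group) r"
    unfolding linear_order_on_def partial_order_on_def preorder_on_def
    by (auto simp: r_def refl_on_def trans_def antisym_def total_on_def)
  moreover have "\<forall>x\<in>carrier affine_group. \<forall>y\<in>carrier affine_group. \<forall>z\<in>carrier affine_group.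
      (y, z) \<in> r - Id \<longrightarrow>
      (x \<otimes>\<^bsub>affine_group\<^esub> y, x \<otimes>\<^bsub>affine_group\<^esub> z) \<in> r - Id \<and>
      (y \<otimes>\<^bsub>affine_group\<^esub> x, z \<otimes>\<^bsub>affine_group\<^esub> x) \<in> r - Id"
    by (auto simp: r_def)
  ultimately show ?thesis
    unfolding linearly_orderable_def by blast
qed

lemma affine_group_pow:
  "(a, b) [^]\<^bsub>affine_group\<^esub> (n :: nat) = (a ^ n, b * (\<Sum>i<n. a ^ i))"
  by (induction n) (auto simp: nat_pow_def algebra_simps)

text \<open>The value \<open>1\<close> satisfies the equation when \<open>m = n\<close>; otherwise a root lies strictly
  on one side of \<open>1\<close>. The interval \<open>[0, 2]\<close> covers all cases at once: at \<open>0\<close> the left side is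
  \<open>0\<close> and the right side is \<open>1\<close>, while at \<open>2\<close> the left side is at least \<open>2\<^sup>m\<close> and the right side
  is \<open>2\<^sup>m - 1\<close>.\<close>

lemma slope_exists:
  fixes m n :: nat
  assumes "m > 0" "n > 0"
  obtains a :: real where "a > 0" "a ^ m * (\<Sum>i<n. a ^ i) = (\<Sum>i<m. a ^ i)"
proof -
  define g :: "real \<Rightarrow> real" where "g a = a ^ m * (\<Sum>i<n. a ^ i) - (\<Sum>i<m. a ^ i)" for a
  have g0: "g 0 = -1"
    using assms by (simp add: g_def power_0_left)
  have "(2 :: real) ^ m * 1 \<le> 2 ^ m * (\<Sum>i<n. 2 ^ i)"
    using assms member_le_sum[of 0 "{..<n}" "\<lambda>i. (2 :: real) ^ i"] by (intro mult_left_mono) auto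
  moreover have "(\<Sum>i<m. (2 :: real) ^ i) = 2 ^ m - 1"
    using geometric_sum[of "2 :: real" m] by simp
  ultimately have "0 \<le> g 2"
    unfolding g_def by linarith
  moreover have "continuous_on {0..2} g"
    unfolding g_def by (intro continuous_intros)
  ultimately obtain a where a: "0 \<le> a" "g a = 0"
    using IVT'[of g 0 0 2] g0 by auto
  moreover have "a \<noteq> 0"
    using a g0 by auto
  ultimately show thesis
    using that[of a] by (simp add: g_def)
qed

section \<open>A two-element set with small sum of dilates\<close>

theorem theorem3:
  fixes k l :: int
  assumes "k > 0" and "l > 0"
  shows "\<exists>(G :: nat monoid) X. group G \<and> linearly_orderable G \<and>
    X \<subseteq> carrier G \<and> card X = 2 \<and>
    card (dilate G k X <#>\<^bsub>G\<^esub> dilate G l X) < 3 * card X - 2"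
proof -
  interpret A: group affine_group by (rule group_affine_group)
  obtain m n where kl: "k = int m" "l = int n" and "m > 0" "n > 0"
    using assms zero_less_imp_eq_int by meson
  then obtain a :: real where a: "a > 0" "a ^ m * (\<Sum>i<n. a ^ i) = (\<Sum>i<m. a ^ i)"
    using slope_exists by blast
  have in_A: "(a, 0) \<in> carrier affine_group" "(a, 1) \<in> carrier affine_group"
    using a by auto
  have affine_coincidence: "(a, 0) [^]\<^bsub>affine_group\<^esub> k \<otimes>\<^bsub>affine_group\<^esub> (a, 1) [^]\<^bsub>affine_group\<^esub> l =
      (a, 1) [^]\<^bsub>affine_group\<^esub> k \<otimes>\<^bsub>affine_group\<^esub> (a, 0) [^]\<^bsub>affine_group\<^esub> l"
    using a by (simp add: kl int_pow_int affine_group_pow)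

  obtain G :: "nat monoid" and h where G: "group G" and hom: "h \<in> hom G affine_group"
    and inj: "inj_on h (carrier G)" and sub: "{(a, 0), (a, 1)} \<subseteq> h ` carrier G"
    by (rule A.countable_subset_embeds[of "{(a, 0), (a, 1)}"]) (use in_A in auto)
  interpret G: group G by (fact G)
  interpret h: group_hom G affine_group h
    by unfold_locales (fact hom)
  obtain x y where xy: "x \<in> carrier G" "y \<in> carrier G" "h x = (a, 0)" "h y = (a, 1)"
    using sub by auto
  then have "x \<noteq> y" by auto
  have coincidence: "x [^]\<^bsub>G\<^esub> k \<otimes>\<^bsub>G\<^esub> y [^]\<^bsub>G\<^esub> l = y [^]\<^bsub>G\<^esub> k \<otimes>\<^bsub>G\<^esub> x [^]\<^bsub>G\<^esub> l"
    using affine_coincidence xy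
    by (intro inj_onD[OF inj]) (simp_all add: h.hom_int_pow)

  let ?D = "dilate G k {x, y} <#>\<^bsub>G\<^esub> dilate G l {x, y}"
  let ?E = "{x [^]\<^bsub>G\<^esub> k \<otimes>\<^bsub>G\<^esub> x [^]\<^bsub>G\<^esub> l, x [^]\<^bsub>G\<^esub> k \<otimes>\<^bsub>G\<^esub> y [^]\<^bsub>G\<^esub> l, y [^]\<^bsub>G\<^esub> k \<otimes>\<^bsub>G\<^esub> y [^]\<^bsub>G\<^esub> l}"
  have "?D \<subseteq> ?E"
    using coincidence by (auto simp: dilate_def set_mult_def)
  then have "card ?D \<le> card ?E"
    by (intro card_mono) auto
  also have "card ?E \<le> 3"
    by (simp add: card_insert_if)
  finally have "card ?D < 3 * card {x, y} - 2"
    using \<open>x \<noteq> y\<close> by simp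
  moreover have "linearly_orderable G"
    using linearly_orderable_affine_group G hom inj by (rule linearly_orderable_pullback)
  ultimately show ?thesis
    using G xy \<open>x \<noteq> y\<close> by (intro exI[of _ G] exI[of _ "{x, y}"]) auto
qed

end
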